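(* Let $T\in \mathcal{B}_A(\mathcal{H})$. Then $$d\omega_A(T) \leq \sqrt{\max\left\{\omega_A(T), \omega_A(T^\sharp T)\right\}\sqrt{\omega_A\left((T^\sharp T)^2 + T^\sharp T\right) + 2\,\omega_A(T^\sharp T^2)}}.$$
   Context: $\mathcal{H}$ is a complex Hilbert space with inner product $\langle\cdot\mid\cdot\rangle$, $\mathcal{B}(\mathcal{H})$ is the algebra of bounded linear operators on $\mathcal{H}$, and $A\in\mathcal{B}(\mathcal{H})$ is a fixed nonzero positive (semidefinite) operator. Put $\langle x\mid y\rangle_A=\langle Ax\mid y\rangle$ and $\|x\|_A=\langle x\mid x\rangle_A^{1/2}$. $\mathcal{B}_A(\mathcal{H})=\{T\in\mathcal{B}(\mathcal{H}) : \mathcal{R}(T^*A)\subseteq\mathcal{R}(A)\}$, where $\mathcal{R}$ denotes range; for $T\in\mathcal{B}_A(\mathcal{H})$, $T^\sharp$ denotes the unique $X\in\mathcal{B}(\mathcal{H})$ with $AX=T^*A$ and $\mathcal{R}(X)\subseteq\overline{\mathcal{R}(A)}$ (so $\langle Tx\mid y\rangle_A=\langle x\mid T^\sharp y\rangle_A$); $T^\sharp T^2$ means the product $T^\sharp\cdot T\cdot T$. For $T\in\mathcal{B}_A(\mathcal{H})$: $\omega_A(T)=\sup\{|\langle Tx\mid x\rangle_A| : \|x\|_A=1\}$, and the $A$-Davis-Wielandt radius is $d\omega_A(T)=\sup\{\sqrt{|\langle Tx\mid x\rangle_A|^2+\|Tx\|_A^4} : \|x\|_A=1\}$; both are finite.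 *)

theory Defs
  imports "HOL-Analysis.Analysis"
begin

class complex_vector = real_vector +
  fixes scaleC :: "complex \<Rightarrow> 'a \<Rightarrow> 'a"  (infixr "*\<^sub>C" 75)
  assumes scaleC_add_right: "a *\<^sub>C (x + y) = a *\<^sub>C x + a *\<^sub>C y"
    and scaleC_add_left: "(a + b) *\<^sub>C x = a *\<^sub>C x + b *\<^sub>C x"
    and scaleC_scaleC: "a *\<^sub>C (b *\<^sub>C x) = (a * b) *\<^sub>C x"
    and scaleC_one: "1 *\<^sub>C x = x"
    and scaleR_scaleC: "r *\<^sub>R x = complex_of_real r *\<^sub>C x"

text \<open>The inner product is linear in its first argument. The underlying real inner product
  \<open>x \<bullet> y\<close> is the real part of \<open>cinner x y\<close>; thus positive definiteness of \<open>cinner\<close>, and the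
  fact that the norm and the topology are the ones induced by \<open>cinner\<close>, are inherited
  from class \<open>real_inner\<close>.\<close>

class complex_inner = complex_vector + real_inner +
  fixes cinner :: "'a \<Rightarrow> 'a \<Rightarrow> complex"
  assumes cinner_add_left: "cinner (x + y) z = cinner x z + cinner y z"
    and cinner_scaleC_left: "cinner (a *\<^sub>C x) y = a * cinner x y"
    and cinner_commute: "cinner x y = cnj (cinner y x)"
    and Re_cinner: "Re (cinner x y) = inner x y"

class chilbert_space = complex_inner + complete_space

lemma cinner_self: "cinner x x = complex_of_real ((norm x)\<^sup>2)"
proof (rule complex_eqI)
  have "Im (cinner x x) = - Im (cinner x x)"
    by (metis cinner_commute cnj.simps(2))
  then show "Im (cinner x x) = Im (complex_of_real ((norm x)\<^sup>2))"
    by simp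
qed (simp add: Re_cinner power2_norm_eq_inner)

instantiation complex :: chilbert_space
begin
definition scaleC_complex :: "complex \<Rightarrow> complex \<Rightarrow> complex"
  where "scaleC_complex a x = a * x"
definition cinner_complex :: "complex \<Rightarrow> complex \<Rightarrow> complex"
  where "cinner_complex x y = x * cnj y"
instance
  by standard
    (auto simp: scaleC_complex_def cinner_complex_def algebra_simps scaleR_conv_of_real
      inner_complex_def)
end

definition bounded_clinear :: "('a::complex_inner \<Rightarrow> 'a) \<Rightarrow> bool"
  where "bounded_clinear T \<longleftrightarrow> bounded_linear T \<and> (\<forall>a x. T (a *\<^sub>C x) = a *\<^sub>C T x)"

definition positive_op :: "('a::complex_inner \<Rightarrow> 'a) \<Rightarrow> bool"
  where "positive_op A \<longleftrightarrow> bounded_clinear A \<and>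
    (\<forall>x. cinner (A x) x \<in> \<real> \<and> 0 \<le> Re (cinner (A x) x))"

text \<open>The description denotes for every bounded operator, by the Riesz representation theorem.\<close>

definition cadjoint :: "('a::chilbert_space \<Rightarrow> 'a) \<Rightarrow> ('a \<Rightarrow> 'a)"
  where "cadjoint T = (THE S. bounded_clinear S \<and> (\<forall>x y. cinner (T x) y = cinner x (S y)))"

definition A_inner :: "('a::complex_inner \<Rightarrow> 'a) \<Rightarrow> 'a \<Rightarrow> 'a \<Rightarrow> complex"
  where "A_inner A x y = cinner (A x) y"

text \<open>For positive \<open>A\<close> the number \<open>A_inner A x x\<close> is real, so nothing is lost by \<open>Re\<close>.\<close>

definition A_norm :: "('a::complex_inner \<Rightarrow> 'a) \<Rightarrow> 'a \<Rightarrow> real"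
  where "A_norm A x = sqrt (Re (A_inner A x x))"

definition A_bounded_ops :: "('a::chilbert_space \<Rightarrow> 'a) \<Rightarrow> ('a \<Rightarrow> 'a) set"
  where "A_bounded_ops A = {T. bounded_clinear T \<and> range (cadjoint T \<circ> A) \<subseteq> range A}"

text \<open>The description denotes for positive \<open>A\<close> and \<open>T \<in> A_bounded_ops A\<close>: existence is Douglas'
  range inclusion theorem, and uniqueness holds because \<open>A\<close> is injective on the closure of its
  range.\<close>

definition A_sharp :: "('a::chilbert_space \<Rightarrow> 'a) \<Rightarrow> ('a \<Rightarrow> 'a) \<Rightarrow> ('a \<Rightarrow> 'a)"
  where "A_sharp A T =
    (THE X. bounded_clinear X \<and> A \<circ> X = cadjoint T \<circ> A \<and> range X \<subseteq> closure (range A))"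

text \<open>Both suprema are taken in \<open>real\<close>. For a nonzero positive \<open>A\<close> and \<open>T \<in> A_bounded_ops A\<close>
  the sets are nonempty and bounded above.\<close>

definition A_numerical_radius :: "('a::complex_inner \<Rightarrow> 'a) \<Rightarrow> ('a \<Rightarrow> 'a) \<Rightarrow> real"
  where "A_numerical_radius A T = Sup {cmod (A_inner A (T x) x) |x. A_norm A x = 1}"

definition A_davis_wielandt_radius :: "('a::complex_inner \<Rightarrow> 'a) \<Rightarrow> ('a \<Rightarrow> 'a) \<Rightarrow> real"
  where "A_davis_wielandt_radius A T =
    Sup {sqrt ((cmod (A_inner A (T x) x))\<^sup>2 + A_norm A (T x) ^ 4) |x. A_norm A x = 1}"

end

theory Submission
  imports Defs
begin

text \<open>Let \<open>P = T\<^sup>\<sharp> T\<close>, \<open>\<parallel>x\<parallel>\<^sub>A = 1\<close>, \<open>a = |\<langle>T x, x\<rangle>\<^sub>A|\<close> and \<open>b = \<parallel>T x\<parallel>\<^sub>A\<^sup>2 = \<langle>P x, x\<rangle>\<^sub>A\<close>. Then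
  \<open>a\<^sup>2 + b\<^sup>2 \<le> max a b * (a + b)\<close>, and for a suitable phase \<open>c\<close> we have
  \<open>a + b = \<langle>(c T + P) x, x\<rangle>\<^sub>A \<le> \<parallel>(c T + P) x\<parallel>\<^sub>A\<close>. Since \<open>\<langle>T x, P x\<rangle>\<^sub>A = \<langle>T\<^sup>\<sharp> T\<^sup>2 x, x\<rangle>\<^sub>A\<close>, the square of
  the right-hand side is \<open>\<langle>(P\<^sup>2 + P) x, x\<rangle>\<^sub>A + 2 Re (c \<langle>T\<^sup>\<sharp> T\<^sup>2 x, x\<rangle>\<^sub>A)\<close>. What remains is to show that
  \<open>T\<^sup>\<sharp>\<close> exists and that \<open>T\<close> and \<open>T\<^sup>\<sharp>\<close> are bounded in the seminorm, so that all suprema are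
  finite.\<close>

section \<open>Real quadratics and complex phases\<close>

text \<open>For \<open>a > 0\<close> the value at the minimiser \<open>- b / a\<close> gives the
  claim. If \<open>a < 0\<close>, or if \<open>a = 0\<close> and \<open>b \<noteq> 0\<close>, the
  quadratic would be negative somewhere.\<close>

lemma quadratic_nonneg_imp_discriminant_le:
  fixes a b c :: real
  assumes "\<And>t. 0 \<le> a * t\<^sup>2 + 2 * b * t + c"
  shows "b\<^sup>2 \<le> a * c"
proof (cases "a = 0")
  case True
  have "b = 0"
  proof (rule ccontr)
    assume "b \<noteq> 0"
    \<comment> \<open>At this \<open>t\<close> the affine function \<open>2 * b * t + c\<close>
      equals -1.\<close>
    then show False
      using assms[of "- (c + 1) / (2 * b)"] True by simp
  qed
  then show ?thesis using True by simp
next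
  case False
  have "a > 0"
  proof (rule ccontr)
    assume "\<not> a > 0"
    then have "a < 0" using False by simp
    \<comment> \<open>Chosen so that \<open>t \<ge> 1\<close> and
      \<open>a * t + 2 * b \<le> a - \<bar>c\<bar> < 0\<close>; multiplying by \<open>t\<close> and
      adding \<open>c\<close> then leaves at most \<open>a\<close>.\<close>
    define t where "t = 1 + (2 * \<bar>b\<bar> + \<bar>c\<bar>) / (- a)"
    have at: "a * t = a - 2 * \<bar>b\<bar> - \<bar>c\<bar>"
      using \<open>a < 0\<close> by (simp add: t_def field_simps)
    have "t \<ge> 1" using \<open>a < 0\<close> by (simp add: t_def divide_nonneg_neg)
    have "a * t\<^sup>2 + 2 * b * t + c = t * (a * t + 2 * b) + c"
      by (simp add: power2_eq_square algebra_simps)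
    also have "\<dots> = t * (a - 2 * \<bar>b\<bar> - \<bar>c\<bar> + 2 * b) + c"
      by (simp only: at)
    also have "\<dots> \<le> t * (a - \<bar>c\<bar>) + c"
      using \<open>t \<ge> 1\<close> by (intro add_right_mono mult_left_mono) auto
    also have "\<dots> \<le> 1 * (a - \<bar>c\<bar>) + c"
      using \<open>t \<ge> 1\<close> \<open>a < 0\<close> by (intro add_right_mono mult_right_mono_neg) auto
    also have "\<dots> < 0" using \<open>a < 0\<close> by simp
    finally show False using assms[of t] by simp
  qed
  then show ?thesis
    using assms[of "- b / a"] by (simp add: power2_eq_square field_simps)
qed

text \<open>Rotating by such a phase turns a bound on real parts into a bound on moduli.\<close>

lemma exists_phase: "\<exists>c. cmod c = 1 \<and> c * z = complex_of_real (cmod z)"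
proof (cases "z = 0")
  case False
  then have "cnj z / cmod z * z = complex_of_real (cmod z)"
    by (simp add: field_simps complex_norm_square[symmetric] power2_eq_square)
  then show ?thesis
    using False by (intro exI[of _ "cnj z / cmod z"]) (simp add: norm_divide)
qed (auto intro: exI[of _ 1])

section \<open>Riesz representation and uniform boundedness\<close>

text \<open>The representing vector minimises \<open>\<parallel>x\<parallel>\<^sup>2 - 2 f x\<close> over \<open>M\<close>; minimising sequences are
  Cauchy by the parallelogram law.\<close>

lemma riesz_closed_subspace:
  fixes f :: "'a::{real_inner,complete_space} \<Rightarrow> real"
  assumes f: "bounded_linear f" and M: "closed M" "subspace M"
  shows "\<exists>p\<in>M. \<forall>m\<in>M. inner p m = f m"
proof -
  interpret f: bounded_linear f by fact
  define J where "J x = inner x x - 2 * f x" for x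
  obtain K where K: "\<And>x. norm (f x) \<le> norm x * K" using f.bounded by blast
  have lb: "- K\<^sup>2 \<le> J x" for x
  proof -
    have "0 \<le> (norm x - K)\<^sup>2" by simp
    then show ?thesis
      using K[of x] by (simp add: J_def power2_norm_eq_inner[symmetric] power2_diff)
  qed
  define d where "d = Inf (J ` M)"
  have bdd: "bdd_below (J ` M)" using lb by (auto intro: bdd_belowI[of _ "- K\<^sup>2"])
  have dle: "d \<le> J x" if "x \<in> M" for x
    unfolding d_def using bdd that by (intro cInf_lower) auto
  have "J ` M \<noteq> {}" using subspace_0[OF M(2)] by auto
  define e where "e n = inverse (real (Suc n))" for n
  have "\<exists>x\<in>M. J x < d + e n" for n
    using cInf_lessD[of "J ` M" "d + e n"] unfolding d_def e_def using \<open>J ` M \<noteq> {}\<close> by auto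
  then obtain X where X: "\<And>n. X n \<in> M" "\<And>n. J (X n) < d + e n" by metis
  \<comment> \<open>The midpoint of \<open>X m\<close> and \<open>X n\<close> lies in
    \<open>M\<close>, so \<open>J\<close> is at least \<open>d\<close> there, while the linear terms
    cancel in \<open>J (X m) + J (X n) - 2 * J y\<close>.\<close>
  have par: "(norm (X m - X n))\<^sup>2 \<le> 2 * (e m + e n)" for m n
  proof -
    define y where "y = (1/2) *\<^sub>R (X m + X n)"
    have "y \<in> M" unfolding y_def using M(2) X(1) by (intro subspace_scale subspace_add)
    have "J (X m) + J (X n) - 2 * J y = (norm (X m - X n))\<^sup>2 / 2"
      unfolding J_def power2_norm_eq_inner y_def f.scaleR f.add
      by (simp add: inner_add_left inner_add_right inner_diff_left inner_diff_right
          inner_commute algebra_simps)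
    moreover have "J (X m) + J (X n) - 2 * J y \<le> e m + e n"
      using X(2)[of m] X(2)[of n] dle[OF \<open>y \<in> M\<close>] by linarith
    ultimately have "(norm (X m - X n))\<^sup>2 / 2 \<le> e m + e n" by metis
    then show ?thesis by simp
  qed
  have "Cauchy X"
  proof (rule metric_CauchyI)
    fix \<epsilon> :: real assume "\<epsilon> > 0"
    \<comment> \<open>The 4 comes from \<open>par\<close>: two errors of at most \<open>e N\<close>
      each, times 2.\<close>
    then obtain N where N: "e N < \<epsilon>\<^sup>2 / 4"
      using reals_Archimedean[of "\<epsilon>\<^sup>2 / 4"] unfolding e_def by auto
    have "dist (X m) (X n) < \<epsilon>" if "m \<ge> N" "n \<ge> N" for m n
    proof -
      have "e m \<le> e N" "e n \<le> e N"
        using that by (auto simp: e_def)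
      then have "(norm (X m - X n))\<^sup>2 < \<epsilon>\<^sup>2"
        using par[of m n] N by simp
      then show ?thesis
        using \<open>\<epsilon> > 0\<close> by (auto simp: dist_norm intro: power2_less_imp_less)
    qed
    then show "\<exists>N. \<forall>m\<ge>N. \<forall>n\<ge>N. dist (X m) (X n) < \<epsilon>" by blast
  qed
  then obtain p where p: "X \<longlonglongrightarrow> p" using Cauchy_convergent convergent_def by blast
  have "p \<in> M" using closed_sequentially[OF M(1) X(1) p] .
  have "(\<lambda>n. J (X n)) \<longlonglongrightarrow> J p"
    unfolding J_def using p by (intro tendsto_intros f.tendsto)
  moreover have "(\<lambda>n. d + e n) \<longlonglongrightarrow> d + 0"
    unfolding e_def by (intro tendsto_intros LIMSEQ_inverse_real_of_nat)
  ultimately have "J p \<le> d + 0"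
    using X(2) by (intro LIMSEQ_le) (auto intro: less_imp_le)
  then have Jp: "J p \<le> J x" if "x \<in> M" for x using dle[OF that] by simp
  have "inner p m = f m" if "m \<in> M" for m
  proof -
    \<comment> \<open>This is \<open>J (p + t m) - J p\<close>. Having no constant term, it forces
      the linear coefficient to vanish.\<close>
    have "0 \<le> inner m m * t\<^sup>2 + 2 * (inner p m - f m) * t + 0" for t
    proof -
      have "p + t *\<^sub>R m \<in> M" using \<open>p \<in> M\<close> that M(2) by (intro subspace_scale subspace_add)
      then have "J p \<le> J (p + t *\<^sub>R m)" by (rule Jp)
      then show ?thesis
        unfolding J_def f.add f.scaleR
        by (simp add: inner_add_left inner_add_right inner_commute algebra_simps power2_eq_square)
    qed
    from quadratic_nonneg_imp_discriminant_le[OF this] show ?thesis by simp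
  qed
  with \<open>p \<in> M\<close> show ?thesis by blast
qed

text \<open>Uniform boundedness principle. By Baire some \<open>F n\<close> contains a ball, and
  testing \<open>w\<close> at the centre and at the boundary point in direction \<open>w\<close>
  bounds \<open>norm w\<close>.\<close>

lemma weakly_bounded_imp_bounded:
  fixes W :: "'a::{real_inner,complete_space} set"
  assumes "\<And>y. \<exists>B. \<forall>w\<in>W. \<bar>inner w y\<bar> \<le> B"
  shows "bounded W"
proof -
  define F where "F n = {y. \<forall>w\<in>W. \<bar>inner w y\<bar> \<le> real n}" for n
  have cl: "closed (F n)" for n
  proof -
    have "F n = (\<Inter>w\<in>W. {y. \<bar>inner w y\<bar> \<le> real n})" by (auto simp: F_def)
    also have "closed \<dots>" by (intro closed_INT ballI closed_Collect_le continuous_intros)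
    finally show ?thesis .
  qed
  have "(\<Union>n. F n) = UNIV"
  proof -
    have "\<exists>n. y \<in> F n" for y
    proof -
      obtain B where "\<forall>w\<in>W. \<bar>inner w y\<bar> \<le> B" using assms by blast
      moreover obtain n where "B \<le> real n" using real_arch_simple by blast
      ultimately have "y \<in> F n" unfolding F_def by (blast intro: order_trans)
      then show ?thesis ..
    qed
    then show ?thesis by blast
  qed
  have "\<exists>n. interior (F n) \<noteq> {}"
  proof (rule ccontr)
    assume "\<not> ?thesis"
    then have "euclidean interior_of \<Union> (range F) = {}"
      using cl by (intro Baire_category_alt disjI1 completely_metrizable_space_euclidean) auto
    with \<open>(\<Union>n. F n) = UNIV\<close> show False by simp
  qed
  then obtain n c where "c \<in> interior (F n)" by blast
  then obtain r where r: "r > 0" "cball c r \<subseteq> F n"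
    by (meson mem_interior_cball)
  have "norm w \<le> 2 * real n / r" if "w \<in> W" for w
  proof (cases "w = 0")
    case False
    have "c + (r / norm w) *\<^sub>R w \<in> cball c r"
      using r(1) False by (simp add: dist_norm)
    then have "\<bar>inner w (c + (r / norm w) *\<^sub>R w)\<bar> \<le> real n"
      using r(2) \<open>w \<in> W\<close> by (auto simp: F_def)
    moreover have "inner w (c + (r / norm w) *\<^sub>R w) = inner w c + r * norm w"
      using False
      by (simp add: inner_add_right power2_norm_eq_inner[symmetric] power2_eq_square)
    moreover have "\<bar>inner w c\<bar> \<le> real n"
      using r \<open>w \<in> W\<close> by (auto simp: F_def subset_iff)
    ultimately have "r * norm w \<le> 2 * real n" by linarith
    then show ?thesis using r(1) by (simp add: field_simps)
  qed (use r(1) in auto)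
  then show ?thesis by (auto simp: bounded_iff)
qed

section \<open>Complex inner product and adjoint\<close>

lemma cinner_scaleC_right: "cinner x (a *\<^sub>C y) = cnj a * cinner x y"
  by (metis cinner_commute cinner_scaleC_left complex_cnj_mult)

lemma cinner_add_right: "cinner x (y + z) = cinner x y + cinner x z"
  by (metis cinner_commute cinner_add_left complex_cnj_add)

lemma Im_cinner: "Im (cinner x y) = - inner (\<i> *\<^sub>C x) y"
  by (simp flip: Re_cinner add: cinner_scaleC_left)

text \<open>The multiples by 1 and \<i> give the real and the imaginary part, so real Riesz
  representation suffices for complex adjoints.\<close>

lemma cinner_eqI:
  assumes "\<And>a. inner (a *\<^sub>C x) y = inner (a *\<^sub>C u) v"
  shows "cinner x y = cinner u v"
  using assms[of 1] assms[of \<i>] by (simp add: complex_eq_iff Re_cinner Im_cinner scaleC_one)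

lemma norm_scaleC: "norm (a *\<^sub>C x) = cmod a * norm (x::'a::complex_inner)"
proof -
  have "complex_of_real ((norm (a *\<^sub>C x))\<^sup>2) = complex_of_real ((cmod a * norm x)\<^sup>2)"
    unfolding cinner_self[symmetric] cinner_scaleC_left cinner_scaleC_right
      mult.assoc[symmetric] mult.commute[of "cnj a" a] complex_norm_square[symmetric]
    by (simp add: cinner_self power_mult_distrib)
  then have "(norm (a *\<^sub>C x))\<^sup>2 = (cmod a * norm x)\<^sup>2" by (simp only: of_real_eq_iff)
  then show ?thesis by simp
qed

lemma bounded_linear_scaleC: "bounded_linear (\<lambda>x::'a::complex_inner. a *\<^sub>C x)"
  by (rule bounded_linear_intro[where K = "cmod a"])
    (simp_all add: scaleC_add_right scaleR_scaleC scaleC_scaleC norm_scaleC mult.commute)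

lemma bounded_clinearD:
  assumes "bounded_clinear T"
  shows "bounded_linear T" "T (a *\<^sub>C x) = a *\<^sub>C T x" "T (x + y) = T x + T y"
  using assms by (auto simp: bounded_clinear_def linear_simps)

text \<open>\<open>S y\<close> is the Riesz vector of the functional that sends \<open>x\<close> to
  \<open>inner (T x) y\<close>. Linearity follows from nondegeneracy, and boundedness from pairing
  \<open>S y\<close> with itself.\<close>

lemma cadjoint_unique_existence:
  fixes T :: "'a::chilbert_space \<Rightarrow> 'a"
  assumes T: "bounded_clinear T"
  shows "\<exists>!S. bounded_clinear S \<and> (\<forall>x y. cinner (T x) y = cinner x (S y))"
proof -
  interpret T: bounded_linear T using T by (rule bounded_clinearD)
  have "\<exists>s. \<forall>x. inner s x = inner (T x) y" for y
  proof -
    have "bounded_linear (\<lambda>x. inner (T x) y)"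
      using T.bounded_linear_axioms by (rule bounded_linear_inner_left_comp)
    from riesz_closed_subspace[OF this, of UNIV] show ?thesis by auto
  qed
  then obtain S where S: "\<And>x y. inner (S y) x = inner (T x) y" by metis
  have adj: "cinner (T x) y = cinner x (S y)" for x y
  proof (rule cinner_eqI)
    fix a show "inner (a *\<^sub>C T x) y = inner (a *\<^sub>C x) (S y)"
      using S[of y "a *\<^sub>C x"] by (simp add: bounded_clinearD(2)[OF T] inner_commute)
  qed
  have eqI: "u = v" if "\<And>x. cinner x u = cinner x v" for u v :: 'a
  proof -
    have "inner x (u - v) = 0" for x
      using that[of x] by (metis Re_cinner inner_diff_right right_minus_eq)
    from this[of "u - v"] show ?thesis by simp
  qed
  have add: "S (x + y) = S x + S y" for x y
    by (rule eqI) (simp add: cinner_add_right flip: adj)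
  have scale: "S (a *\<^sub>C x) = a *\<^sub>C S x" for a x
    by (rule eqI) (simp add: cinner_scaleC_right flip: adj)
  obtain K where K: "\<And>x. norm (T x) \<le> norm x * K" and "K \<ge> 0"
    using T.nonneg_bounded by blast
  have "norm (S y) \<le> norm y * K" for y
  proof (cases "S y = 0")
    case False
    have "norm (S y) * norm (S y) = inner (T (S y)) y"
      by (simp add: norm_eq_sqrt_inner flip: S)
    also have "\<dots> \<le> norm (T (S y)) * norm y" by (rule norm_cauchy_schwarz)
    also have "\<dots> \<le> norm (S y) * (norm y * K)"
      using mult_right_mono[OF K[of "S y"], of "norm y"] by (simp add: mult_ac)
    finally show ?thesis using False by simp
  qed (use \<open>K \<ge> 0\<close> in simp)
  then have "bounded_clinear S"
    unfolding bounded_clinear_def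
    by (auto intro!: bounded_linear_intro[where K = K] simp: add scale scaleR_scaleC)
  then show ?thesis using adj by (intro ex1I[of _ S]) (auto intro!: eqI ext)
qed

lemma
  assumes "bounded_clinear T"
  shows bounded_clinear_cadjoint: "bounded_clinear (cadjoint T)"
    and cinner_cadjoint: "cinner (T x) y = cinner x (cadjoint T y)"
  using theI'[OF cadjoint_unique_existence[OF assms], folded cadjoint_def] by blast+

section \<open>The semi-inner product and its seminorm\<close>

context
  fixes A :: "'a::complex_inner \<Rightarrow> 'a"
  assumes A: "positive_op A"
begin

lemma bounded_clinear_positive: "bounded_clinear A"
  using A by (simp add: positive_op_def)

lemma bounded_linear_positive: "bounded_linear A"
  using bounded_clinear_positive by (rule bounded_clinearD)

lemma A_inner_add_left: "A_inner A (x + y) z = A_inner A x z + A_inner A y z"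
  and A_inner_add_right: "A_inner A z (x + y) = A_inner A z x + A_inner A z y"
  and A_inner_scaleC_left: "A_inner A (a *\<^sub>C x) y = a * A_inner A x y"
  and A_inner_scaleC_right: "A_inner A x (a *\<^sub>C y) = cnj a * A_inner A x y"
  by (simp_all add: A_inner_def bounded_clinearD[OF bounded_clinear_positive] cinner_add_left
      cinner_add_right cinner_scaleC_left cinner_scaleC_right)

lemma Im_A_inner_self: "Im (A_inner A x x) = 0"
  and Re_A_inner_self: "Re (A_inner A x x) \<ge> 0"
  using A by (auto simp: positive_op_def A_inner_def complex_is_Real_iff)

text \<open>Polarisation: the form is real on the diagonal, and expanding it at \<open>x + y\<close>
  and at \<open>x + \<i> *\<^sub>C y\<close> compares imaginary and real parts respectively.\<close>

lemma A_inner_commute: "A_inner A y x = cnj (A_inner A x y)"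
proof (rule complex_eqI)
  show "Im (A_inner A y x) = Im (cnj (A_inner A x y))"
    using Im_A_inner_self[of "x + y"]
    by (simp add: A_inner_add_left A_inner_add_right Im_A_inner_self)
  show "Re (A_inner A y x) = Re (cnj (A_inner A x y))"
    using Im_A_inner_self[of "x + \<i> *\<^sub>C y"]
    by (simp add: A_inner_add_left A_inner_add_right A_inner_scaleC_left A_inner_scaleC_right
        Im_A_inner_self)
qed

lemma positive_selfadjoint: "cinner (A x) y = cinner x (A y)"
  using A_inner_commute[of x y] cinner_commute[of x "A y"] by (simp add: A_inner_def)

lemma positive_selfadjoint_inner: "inner (A x) y = inner x (A y)"
  using positive_selfadjoint[of x y] by (metis Re_cinner)

lemma A_inner_self: "A_inner A x x = complex_of_real ((A_norm A x)\<^sup>2)"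
  by (simp add: complex_eq_iff A_norm_def Im_A_inner_self Re_A_inner_self)

lemma A_norm_nonneg: "A_norm A x \<ge> 0"
  by (simp add: A_norm_def Re_A_inner_self)

lemma power2_A_norm: "(A_norm A x)\<^sup>2 = Re (A_inner A x x)"
  by (simp add: A_inner_self)

lemma A_norm_scaleC: "A_norm A (a *\<^sub>C x) = cmod a * A_norm A x"
proof -
  have "Re (A_inner A (a *\<^sub>C x) (a *\<^sub>C x)) = (cmod a * A_norm A x)\<^sup>2"
    unfolding A_inner_scaleC_left A_inner_scaleC_right A_inner_self[of x] mult.assoc[symmetric]
      complex_norm_square[symmetric]
    by (simp add: power_mult_distrib cmod_power2 flip: power2_eq_square)
  then show ?thesis by (simp add: A_norm_def[of A "a *\<^sub>C x"] A_norm_nonneg)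
qed

text \<open>The squared seminorm of \<open>x + t y\<close> is a nonnegative quadratic in real
  \<open>t\<close>, which bounds the real part. A phase passes to the modulus.\<close>

lemma A_cauchy_schwarz: "cmod (A_inner A x y) \<le> A_norm A x * A_norm A y"
proof -
  have real: "Re (A_inner A x y) \<le> A_norm A x * A_norm A y" for x y
  proof -
    have "0 \<le> (A_norm A y)\<^sup>2 * t\<^sup>2 + 2 * Re (A_inner A x y) * t + (A_norm A x)\<^sup>2" for t
    proof -
      have "0 \<le> Re (A_inner A (x + complex_of_real t *\<^sub>C y) (x + complex_of_real t *\<^sub>C y))"
        by (rule Re_A_inner_self)
      also have "\<dots> = (A_norm A y)\<^sup>2 * t\<^sup>2 + 2 * Re (A_inner A x y) * t + (A_norm A x)\<^sup>2"
        unfolding A_inner_add_left A_inner_add_right A_inner_scaleC_left A_inner_scaleC_right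
          A_inner_self[of x] A_inner_self[of y] A_inner_commute[of y x]
        by (simp add: power2_eq_square algebra_simps)
      finally show ?thesis .
    qed
    from quadratic_nonneg_imp_discriminant_le[OF this]
    have "(Re (A_inner A x y))\<^sup>2 \<le> (A_norm A x * A_norm A y)\<^sup>2"
      by (simp add: power_mult_distrib mult.commute)
    then show ?thesis by (rule power2_le_imp_le) (simp add: A_norm_nonneg)
  qed
  obtain c where c: "cmod c = 1" "c * A_inner A x y = complex_of_real (cmod (A_inner A x y))"
    using exists_phase by blast
  show ?thesis
    using real[of "c *\<^sub>C x" y] c by (simp add: A_inner_scaleC_left A_norm_scaleC)
qed

lemma A_norm_triangle: "A_norm A (x + y) \<le> A_norm A x + A_norm A y"
proof (rule power2_le_imp_le)
  have "(A_norm A (x + y))\<^sup>2 = (A_norm A x)\<^sup>2 + 2 * Re (A_inner A x y) + (A_norm A y)\<^sup>2"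
    unfolding power2_A_norm A_inner_add_left A_inner_add_right A_inner_commute[of y x] by simp
  also have "\<dots> \<le> (A_norm A x)\<^sup>2 + 2 * (A_norm A x * A_norm A y) + (A_norm A y)\<^sup>2"
    using A_cauchy_schwarz[of x y] complex_Re_le_cmod[of "A_inner A x y"] by simp
  finally show "(A_norm A (x + y))\<^sup>2 \<le> (A_norm A x + A_norm A y)\<^sup>2"
    by (simp add: power2_sum algebra_simps)
qed (simp add: A_norm_nonneg)

lemma A_norm_le_norm: "\<exists>B\<ge>0. \<forall>x. A_norm A x \<le> B * norm x"
proof -
  interpret bounded_linear A by (rule bounded_linear_positive)
  obtain K where K: "K \<ge> 0" "\<And>x. norm (A x) \<le> norm x * K" using nonneg_bounded by blast
  have "A_norm A x \<le> sqrt K * norm x" for x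
  proof -
    have "Re (A_inner A x x) \<le> norm (A x) * norm x"
      unfolding A_inner_def Re_cinner by (rule norm_cauchy_schwarz)
    also have "\<dots> \<le> K * (norm x)\<^sup>2"
      using mult_right_mono[OF K(2)[of x], of "norm x"] by (simp add: power2_eq_square mult_ac)
    finally show ?thesis
      unfolding A_norm_def using real_sqrt_le_mono by (fastforce simp: real_sqrt_mult)
  qed
  then show ?thesis using K(1) by (intro exI[of _ "sqrt K"]) simp
qed

text \<open>If \<open>A x \<noteq> 0\<close>, then \<open>A_inner A x (A x)\<close> is the squared
  norm of \<open>A x\<close>, so Cauchy-Schwarz prevents the seminorm of \<open>x\<close> from
  vanishing. This makes the sets under the suprema nonempty.\<close>

lemma exists_A_norm_1:
  assumes "A \<noteq> (\<lambda>x. 0)"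
  shows "\<exists>x. A_norm A x = 1"
proof -
  obtain x where "A x \<noteq> 0" using assms by auto
  then have "A_inner A x (A x) \<noteq> 0" by (simp add: A_inner_def cinner_self)
  then have "A_norm A x \<noteq> 0" using A_cauchy_schwarz[of x "A x"] by auto
  then show ?thesis
    by (intro exI[of _ "complex_of_real (1 / A_norm A x) *\<^sub>C x"])
      (simp add: A_norm_scaleC A_norm_nonneg norm_divide)
qed

text \<open>Iterating \<open>\<parallel>S x\<parallel>\<^sub>A\<^sup>2 = \<langle>x, S\<^sup>2 x\<rangle>\<^sub>A \<le> \<parallel>x\<parallel>\<^sub>A \<parallel>S\<^sup>2 x\<parallel>\<^sub>A\<close> along the powers \<open>S\<^bsup>2^k\<^esup>\<close> bounds the
  growth of \<open>S\<close> in the seminorm by its growth in the norm.\<close>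

lemma A_selfadjoint_imp_A_bounded:
  assumes S: "bounded_linear S" and sym: "\<And>x y. A_inner A (S x) y = A_inner A x (S y)"
  shows "\<exists>K\<ge>0. \<forall>x. A_norm A (S x) \<le> K * A_norm A x"
proof -
  interpret S: bounded_linear S by fact
  obtain K where K: "K > 0" "\<And>x. norm (S x) \<le> norm x * K" using S.pos_bounded by blast
  obtain B where B: "B \<ge> 0" "\<And>x. A_norm A x \<le> B * norm x" using A_norm_le_norm by blast
  have pow: "norm ((S ^^ n) x) \<le> K ^ n * norm x" for n x
  proof (induction n)
    case (Suc n)
    then show ?case
      using order_trans[OF K(2)[of "(S ^^ n) x"] mult_right_mono[OF Suc, of K]] K(1)
      by (simp add: mult_ac)
  qed simp
  have symn: "A_inner A ((S ^^ n) x) y = A_inner A x ((S ^^ n) y)" for n x y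
  proof (induction n arbitrary: x y)
    case (Suc n)
    then show ?case by (simp add: sym funpow_swap1)
  qed simp
  have dbl: "(A_norm A ((S ^^ n) x))\<^sup>2 \<le> A_norm A x * A_norm A ((S ^^ (n + n)) x)" for n x
  proof -
    have "(A_norm A ((S ^^ n) x))\<^sup>2 = Re (A_inner A x ((S ^^ (n + n)) x))"
      unfolding power2_A_norm symn by (simp add: funpow_add)
    also have "\<dots> \<le> A_norm A x * A_norm A ((S ^^ (n + n)) x)"
      using A_cauchy_schwarz complex_Re_le_cmod order_trans by blast
    finally show ?thesis .
  qed
  have "A_norm A (S x) \<le> K * A_norm A x" for x
  proof (cases "A_norm A x = 0")
    case True
    \<comment> \<open>For a null vector \<open>x\<close>, the inequality makes \<open>S x\<close>
      null too.\<close>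
    then show ?thesis using dbl[of 1 x] by simp
  next
    case False
    then have pos: "A_norm A x > 0" using A_norm_nonneg[of x] by simp
    define f where "f n = A_norm A ((S ^^ n) x) / A_norm A x" for n
    have f0: "f n \<ge> 0" for n using pos by (simp add: f_def A_norm_nonneg)
    have f2: "(f n)\<^sup>2 \<le> f (n + n)" for n
      using dbl[of n x] pos by (simp add: f_def power2_eq_square field_simps)
    have fpow: "f 1 ^ (2 ^ k) \<le> f (2 ^ k)" for k
    proof (induction k)
      case (Suc k)
      have "f 1 ^ (2 ^ Suc k) = (f 1 ^ (2 ^ k))\<^sup>2" by (simp add: power_mult[symmetric] mult.commute)
      also have "\<dots> \<le> (f (2 ^ k))\<^sup>2" using Suc f0 by (intro power_mono) auto
      also have "\<dots> \<le> f (2 ^ Suc k)" using f2[of "2 ^ k"] by (simp add: mult_2)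
      finally show ?case .
    qed simp
    define D where "D = B * norm x / A_norm A x"
    have fD: "f n \<le> K ^ n * D" for n
    proof -
      have "A_norm A ((S ^^ n) x) \<le> B * (K ^ n * norm x)"
        using B(2)[of "(S ^^ n) x"] mult_left_mono[OF pow[of n x] B(1)] by linarith
      then show ?thesis using pos by (simp add: f_def D_def field_simps)
    qed
    \<comment> \<open>By \<open>fpow\<close> and \<open>fD\<close>,
      \<open>(f 1 / K) ^ (2 ^ n)\<close> stays below the fixed \<open>D\<close>, which fails for
      large \<open>n\<close> once the ratio exceeds 1.\<close>
    have "f 1 \<le> K"
    proof (rule ccontr)
      assume "\<not> f 1 \<le> K"
      then have "1 < f 1 / K" using K(1) by simp
      then obtain n where n: "D < (f 1 / K) ^ n" using real_arch_pow by blast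
      also have "\<dots> \<le> (f 1 / K) ^ (2 ^ n)"
        using \<open>1 < f 1 / K\<close> by (intro power_increasing) (auto intro: less_imp_le)
      also have "\<dots> \<le> D"
        using order_trans[OF fpow fD, of n] K(1) by (simp add: power_divide field_simps)
      finally show False by simp
    qed
    then show ?thesis using pos by (simp add: f_def field_simps)
  qed
  then show ?thesis using K(1) by (intro exI[of _ K]) auto
qed

text \<open>A real \<open>Sup\<close> dominates its set only if that set is bounded above; the
  seminorm bound \<open>K\<close> ensures this by Cauchy-Schwarz.\<close>

lemma A_numerical_radius_upper:
  assumes "\<And>x. A_norm A (S x) \<le> K * A_norm A x" and "A_norm A x = 1"
  shows "cmod (A_inner A (S x) x) \<le> A_numerical_radius A S"
  unfolding A_numerical_radius_def
proof (rule cSup_upper)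
  show "bdd_above {cmod (A_inner A (S x) x) |x. A_norm A x = 1}"
  proof (rule bdd_aboveI[of _ K], clarify)
    fix x assume "A_norm A x = 1"
    then show "cmod (A_inner A (S x) x) \<le> K"
      using A_cauchy_schwarz[of "S x" x] assms(1)[of x] by simp
  qed
qed (use assms(2) in blast)

end

section \<open>Closure of the range and existence of the sharp operator\<close>

lemma subspace_closure:
  fixes S :: "'a::real_normed_vector set"
  assumes "subspace S"
  shows "subspace (closure S)"
proof (rule subspaceI)
  show "0 \<in> closure S" using subspace_0[OF assms] closure_subset by blast
next
  fix x y assume "x \<in> closure S" "y \<in> closure S"
  then obtain f g where fg: "\<And>n. f n \<in> S" "f \<longlonglongrightarrow> x" "\<And>n. g n \<in> S" "g \<longlonglongrightarrow> y"
    by (auto simp: closure_sequential)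
  then have "(\<lambda>n. f n + g n) \<longlonglongrightarrow> x + y" "\<And>n. f n + g n \<in> S"
    by (auto intro: tendsto_add subspace_add[OF assms])
  then show "x + y \<in> closure S"
    unfolding closure_sequential by (intro exI conjI allI)
next
  fix c x assume "x \<in> closure S"
  then obtain f where f: "\<And>n. f n \<in> S" "f \<longlonglongrightarrow> x"
    by (auto simp: closure_sequential)
  then have "(\<lambda>n. c *\<^sub>R f n) \<longlonglongrightarrow> c *\<^sub>R x" "\<And>n. c *\<^sub>R f n \<in> S"
    by (auto intro: tendsto_scaleR subspace_scale[OF assms])
  then show "c *\<^sub>R x \<in> closure S"
    unfolding closure_sequential by (intro exI conjI allI)
qed

text \<open>\<open>u - v\<close> lies in the kernel of \<open>A\<close>, hence is orthogonal to the
  range of \<open>A\<close> by self-adjointness, and so to its closure, which contains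
  \<open>u\<close> and \<open>v\<close>.\<close>

lemma positive_inj_closure_range:
  fixes A :: "'a::complex_inner \<Rightarrow> 'a"
  assumes A: "positive_op A" and uv: "u \<in> closure (range A)" "v \<in> closure (range A)" "A u = A v"
  shows "u = v"
proof -
  interpret A: bounded_linear A using A by (rule bounded_linear_positive)
  have "inner (u - v) (A w) = 0" for w
    using uv(3) by (simp add: A.diff flip: positive_selfadjoint_inner[OF A])
  then have "closure (range A) \<subseteq> {m. inner (u - v) m = 0}"
    by (intro closure_minimal closed_Collect_eq continuous_intros) auto
  then have "inner (u - v) u = 0" "inner (u - v) v = 0" using uv by auto
  then have "inner (u - v) (u - v) = 0" by (simp only: inner_diff_right)
  then show ?thesis by simp
qed

lemma A_bounded_opsD:
  assumes "T \<in> A_bounded_ops A"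
  shows "bounded_clinear T" "\<exists>z. cadjoint T (A y) = A z"
  using assms by (auto simp: A_bounded_ops_def image_iff subset_iff)

text \<open>Douglas' range inclusion theorem for the equation \<open>A X = T\<^sup>* A\<close>. Each value \<open>X y\<close> is the
  projection of some preimage of \<open>T\<^sup>* A y\<close> to the closure of the range of \<open>A\<close>. Since
  \<open>\<langle>A T w, y\<rangle> = \<langle>A w, X y\<rangle>\<close>, the vectors \<open>A T w / \<parallel>A w\<parallel>\<close> are weakly bounded, hence bounded.\<close>

lemma A_sharp_unique_existence:
  fixes A T :: "'a::chilbert_space \<Rightarrow> 'a"
  assumes A: "positive_op A" and T: "T \<in> A_bounded_ops A"
  shows "\<exists>!X. bounded_clinear X \<and> A \<circ> X = cadjoint T \<circ> A \<and> range X \<subseteq> closure (range A)"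
proof -
  let ?M = "closure (range A)"
  have T': "bounded_clinear T" using T by (rule A_bounded_opsD)
  interpret A: bounded_linear A using A by (rule bounded_linear_positive)
  note A_clin = bounded_clinearD[OF bounded_clinear_positive[OF A]]
  note C_clin = bounded_clinearD[OF bounded_clinear_cadjoint[OF T']]
  have range: "subspace (range A)"
    using linear_subspace_image[OF A.linear_axioms subspace_UNIV] .
  have M: "subspace ?M" using range by (rule subspace_closure)
  have "\<exists>p\<in>?M. A p = cadjoint T (A y)" for y
  proof -
    obtain z where z: "cadjoint T (A y) = A z" using A_bounded_opsD(2)[OF T] by blast
    \<comment> \<open>The Riesz vector in \<open>?M\<close> of the functional \<open>inner z\<close>
      is the orthogonal projection of \<open>z\<close>. Thus \<open>p - z\<close> is orthogonal to
      the range of \<open>A\<close>, which gives \<open>A p = A z\<close>.\<close>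
    obtain p where p: "p \<in> ?M" "\<And>m. m \<in> ?M \<Longrightarrow> inner p m = inner z m"
      using riesz_closed_subspace[OF bounded_linear_inner_right[of z] closed_closure M] by blast
    have "inner (A p - A z) w = 0" for w
      using p(2)[of "A w"] closure_subset[of "range A"]
      by (auto simp: inner_diff_left positive_selfadjoint_inner[OF A])
    from this[of "A p - A z"] show ?thesis using p(1) z by auto
  qed
  then obtain X where XM: "\<And>y. X y \<in> ?M" and AX: "\<And>y. A (X y) = cadjoint T (A y)" by metis
  \<comment> \<open>Linearity of \<open>X\<close> comes from injectivity of \<open>A\<close> on
    \<open>?M\<close>: both sides lie in \<open>?M\<close> and have the same image.\<close>
  have add: "X (x + y) = X x + X y" for x y
    by (rule positive_inj_closure_range[OF A])
      (auto intro!: XM subspace_add[OF M] simp: AX A_clin C_clin)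
  have scale: "X (a *\<^sub>C x) = a *\<^sub>C X x" for a x
  proof (rule positive_inj_closure_range[OF A])
    \<comment> \<open>\<open>subspace\<close> covers only real scalars; for complex ones, continuity
      extends the invariance of the range to its closure.\<close>
    have "(*\<^sub>C) a ` closure (range A) \<subseteq> ?M"
    proof (rule image_closure_subset)
      show "continuous_on ?M ((*\<^sub>C) a)"
        using bounded_linear_scaleC by (rule linear_continuous_on)
      show "(*\<^sub>C) a ` range A \<subseteq> ?M"
        using closure_subset[of "range A"] by (auto simp: subset_iff simp flip: A_clin(2))
    qed auto
    then show "a *\<^sub>C X x \<in> ?M" using XM by auto
  qed (auto intro!: XM simp: AX A_clin C_clin)
  have AT: "inner (A (T w)) y = inner (A w) (X y)" for w y
  proof -
    have "inner (A (T w)) y = inner w (cadjoint T (A y))"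
      unfolding positive_selfadjoint_inner[OF A] by (metis Re_cinner cinner_cadjoint[OF T'])
    then show ?thesis by (simp add: positive_selfadjoint_inner[OF A] AX)
  qed
  let ?W = "{(1 / norm (A w)) *\<^sub>R A (T w) |w. A w \<noteq> 0}"
  have "bounded ?W"
  proof (rule weakly_bounded_imp_bounded, intro exI ballI)
    fix y v assume "v \<in> ?W"
    then obtain w where w: "A w \<noteq> 0" "v = (1 / norm (A w)) *\<^sub>R A (T w)" by blast
    then show "\<bar>inner v y\<bar> \<le> norm (X y)"
      using Cauchy_Schwarz_ineq2[of "A w" "X y"] by (simp add: AT field_simps)
  qed
  then obtain K
    where "K > 0" and K: "\<And>w. A w \<noteq> 0 \<Longrightarrow> norm ((1 / norm (A w)) *\<^sub>R A (T w)) \<le> K"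
    unfolding bounded_pos by blast
  have "norm (X y) \<le> norm y * K" for y
  proof -
    have "inner (X y) (A w) \<le> norm y * K * norm (A w)" for w
    proof (cases "A w = 0")
      case False
      have "inner (X y) (A w) = inner (A (T w)) y"
        by (subst inner_commute) (rule AT[symmetric])
      also have "\<dots> \<le> norm (A (T w)) * norm y" by (rule norm_cauchy_schwarz)
      also have "\<dots> \<le> K * norm (A w) * norm y"
        using K[OF False] False by (intro mult_right_mono) (auto simp: field_simps)
      finally show ?thesis by (simp add: mult_ac)
    qed simp
    \<comment> \<open>The inequality is a closed condition on the second argument, so it extends
      from the range to \<open>?M\<close> and may be used at \<open>X y\<close> itself.\<close>
    then have "?M \<subseteq> {m. inner (X y) m \<le> norm y * K * norm m}"
      by (intro closure_minimal closed_Collect_le continuous_intros) auto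
    then have "inner (X y) (X y) \<le> norm y * K * norm (X y)"
      using XM[of y] by blast
    then have "norm (X y) * norm (X y) \<le> norm y * K * norm (X y)"
      by (simp only: dot_square_norm power2_eq_square)
    then show ?thesis using \<open>K > 0\<close> by (cases "X y = 0") simp_all
  qed
  then have "bounded_clinear X"
    unfolding bounded_clinear_def
    by (auto intro!: bounded_linear_intro[where K = K] simp: add scale scaleR_scaleC)
  moreover have "A \<circ> X = cadjoint T \<circ> A" by (simp add: fun_eq_iff AX)
  moreover have "range X \<subseteq> ?M" using XM by blast
  ultimately have "bounded_clinear X \<and> A \<circ> X = cadjoint T \<circ> A \<and> range X \<subseteq> ?M" by simp
  moreover have "Y = X" if Y: "A \<circ> Y = cadjoint T \<circ> A" "range Y \<subseteq> ?M" for Y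
  proof
    fix y
    have "A (Y y) = A (X y)" using fun_cong[OF Y(1), of y] by (simp add: AX)
    then show "Y y = X y"
      by (rule positive_inj_closure_range[OF A subsetD[OF Y(2) rangeI] XM])
  qed
  ultimately show ?thesis by (rule ex1I) (elim conjE, assumption)+
qed

section \<open>Adjointness and boundedness in the seminorm\<close>

lemma A_inner_sharp:
  assumes "positive_op A" and "T \<in> A_bounded_ops A"
  shows "A_inner A (T x) y = A_inner A x (A_sharp A T y)"
    and "A_inner A (A_sharp A T y) x = A_inner A y (T x)"
    and "bounded_clinear (A_sharp A T)"
proof -
  note sharp = theI'[OF A_sharp_unique_existence[OF assms], folded A_sharp_def]
  show "bounded_clinear (A_sharp A T)" using sharp by blast
  have "A \<circ> A_sharp A T = cadjoint T \<circ> A" using sharp by blast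
  then have "A (A_sharp A T y) = cadjoint T (A y)" by (simp add: fun_eq_iff)
  then show *: "A_inner A (A_sharp A T y) x = A_inner A y (T x)"
    unfolding A_inner_def
    using cinner_cadjoint[OF A_bounded_opsD(1)[OF assms(2)], of x "A y"] by (metis cinner_commute)
  then show "A_inner A (T x) y = A_inner A x (A_sharp A T y)"
    by (metis A_inner_commute[OF assms(1)])
qed

text \<open>The composite of \<open>T\<close> followed by its sharp is symmetric for
  \<open>A_inner\<close>, hence bounded in the seminorm. The squared seminorm of \<open>T x\<close>
  is its form at \<open>x\<close>, which bounds \<open>T\<close>; the bound for the sharp follows
  from that for \<open>T\<close> by adjointness.\<close>

lemma
  assumes A: "positive_op A" and T: "T \<in> A_bounded_ops A"
  shows A_bounded_op: "\<exists>K\<ge>0. \<forall>x. A_norm A (T x) \<le> K * A_norm A x"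
    and A_bounded_sharp: "\<exists>K\<ge>0. \<forall>x. A_norm A (A_sharp A T x) \<le> K * A_norm A x"
proof -
  define X where "X = A_sharp A T"
  note sharp = A_inner_sharp[OF A T, folded X_def]
  have "bounded_linear (\<lambda>x. X (T x))"
    using bounded_linear_compose bounded_clinearD(1) sharp(3) A_bounded_opsD(1)[OF T] by blast
  moreover have "A_inner A (X (T x)) y = A_inner A x (X (T y))" for x y
    by (simp add: sharp)
  ultimately obtain K where K: "K \<ge> 0" "\<And>x. A_norm A (X (T x)) \<le> K * A_norm A x"
    using A_selfadjoint_imp_A_bounded[OF A, of "\<lambda>x. X (T x)"] by blast
  have Tb: "A_norm A (T x) \<le> sqrt K * A_norm A x" for x
  proof (rule power2_le_imp_le)
    have "(A_norm A (T x))\<^sup>2 = Re (A_inner A x (X (T x)))"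
      by (simp add: power2_A_norm[OF A] sharp(1))
    also have "\<dots> \<le> A_norm A x * A_norm A (X (T x))"
      using A_cauchy_schwarz[OF A] complex_Re_le_cmod order_trans by blast
    also have "\<dots> \<le> A_norm A x * (K * A_norm A x)"
      using K A_norm_nonneg[OF A] by (intro mult_left_mono) auto
    finally show "(A_norm A (T x))\<^sup>2 \<le> (sqrt K * A_norm A x)\<^sup>2"
      using K(1) by (simp add: power_mult_distrib power2_eq_square[of "A_norm A x"] mult_ac)
  qed (use K(1) A_norm_nonneg[OF A] in simp)
  then show "\<exists>K\<ge>0. \<forall>x. A_norm A (T x) \<le> K * A_norm A x"
    using K(1) by (intro exI[of _ "sqrt K"]) simp
  have "A_norm A (X y) \<le> sqrt K * A_norm A y" for y
  proof (cases "A_norm A (X y) = 0")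
    case False
    have "(A_norm A (X y))\<^sup>2 = Re (A_inner A y (T (X y)))"
      by (simp add: power2_A_norm[OF A] sharp(2))
    also have "\<dots> \<le> A_norm A y * A_norm A (T (X y))"
      using A_cauchy_schwarz[OF A] complex_Re_le_cmod order_trans by blast
    also have "\<dots> \<le> A_norm A y * (sqrt K * A_norm A (X y))"
      using Tb A_norm_nonneg[OF A] by (intro mult_left_mono) auto
    finally show ?thesis
      using False A_norm_nonneg[OF A, of "X y"] by (simp add: power2_eq_square mult_ac)
  qed (use K(1) A_norm_nonneg[OF A] in simp)
  then show "\<exists>K\<ge>0. \<forall>x. A_norm A (A_sharp A T x) \<le> K * A_norm A x"
    using K(1) unfolding X_def by (intro exI[of _ "sqrt K"]) simp
qed

section \<open>The Davis-Wielandt inequality\<close>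

theorem corollary2p9:
  fixes A T :: "'a::chilbert_space \<Rightarrow> 'a"
  assumes "positive_op A"
    and "A \<noteq> (\<lambda>x. 0)"
    and "T \<in> A_bounded_ops A"
  shows "A_davis_wielandt_radius A T \<le>
    sqrt (max (A_numerical_radius A T) (A_numerical_radius A (A_sharp A T \<circ> T)) *
      sqrt (A_numerical_radius A
              (\<lambda>x. ((A_sharp A T \<circ> T) ^^ 2) x + (A_sharp A T \<circ> T) x)
            + 2 * A_numerical_radius A (A_sharp A T \<circ> T \<circ> T)))"
proof -
  note A = assms(1)
  define X where "X = A_sharp A T"
  define P where "P = X \<circ> T"
  note sharp = A_inner_sharp[OF A assms(3), folded X_def]
  obtain K where K: "K \<ge> 0" "\<And>x. A_norm A (T x) \<le> K * A_norm A x"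
    using A_bounded_op[OF A assms(3)] by blast
  obtain L where L: "L \<ge> 0" "\<And>x. A_norm A (X x) \<le> L * A_norm A x"
    using A_bounded_sharp[OF A assms(3)] unfolding X_def by blast
  \<comment> \<open>Together with \<open>K\<close>, the bounds \<open>P_bd\<close>,
    \<open>PT_bd\<close> and \<open>PP_bd\<close> make \<open>A_numerical_radius_upper\<close>
    applicable to all the radii in the claim.\<close>
  have P_bd: "A_norm A (P x) \<le> L * K * A_norm A x" for x
    using order_trans[OF L(2)[of "T x"] mult_left_mono[OF K(2) L(1)]] by (simp add: P_def mult_ac)
  have PT_bd: "A_norm A ((P \<circ> T) x) \<le> L * K * K * A_norm A x" for x
    using order_trans[OF P_bd[of "T x"] mult_left_mono[OF K(2), of "L * K"]] K(1) L(1)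
    by (simp add: mult_ac)
  have PP: "(P ^^ 2) x = P (P x)" for x
    by (simp add: numeral_2_eq_2)
  have PP_bd: "A_norm A ((P ^^ 2) x + P x) \<le> (L * K * (L * K) + L * K) * A_norm A x" for x
    using A_norm_triangle[OF A, of "P (P x)" "P x"] P_bd[of x]
      order_trans[OF P_bd[of "P x"] mult_left_mono[OF P_bd[of x], of "L * K"]] K(1) L(1)
    by (simp add: PP algebra_simps)
  let ?m = "max (A_numerical_radius A T) (A_numerical_radius A P)"
  let ?s = "A_numerical_radius A (\<lambda>x. (P ^^ 2) x + P x) + 2 * A_numerical_radius A (P \<circ> T)"
  have "sqrt ((cmod (A_inner A (T x) x))\<^sup>2 + A_norm A (T x) ^ 4) \<le> sqrt (?m * sqrt ?s)"
    if x: "A_norm A x = 1" for x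
  proof -
    define a where "a = cmod (A_inner A (T x) x)"
    define b where "b = (A_norm A (T x))\<^sup>2"
    have b: "A_inner A (P x) x = complex_of_real b"
      unfolding P_def b_def comp_apply sharp(2) by (rule A_inner_self[OF A])
    have nonneg: "a \<ge> 0" "b \<ge> 0" by (simp_all add: a_def b_def)
    have am: "a \<le> ?m"
      unfolding a_def using A_numerical_radius_upper[OF A K(2) x] by linarith
    have bm: "b \<le> ?m"
      using A_numerical_radius_upper[OF A P_bd x] nonneg(2) by (simp add: b)
    obtain c where c: "cmod c = 1" "c * A_inner A (T x) x = complex_of_real a"
      unfolding a_def using exists_phase by blast
    define y where "y = c *\<^sub>C T x"
    have "a + b = Re (A_inner A (y + P x) x)"
      by (simp add: y_def A_inner_add_left[OF A] A_inner_scaleC_left[OF A] b c)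
    also have "\<dots> \<le> A_norm A (y + P x)"
      using A_cauchy_schwarz[OF A, of "y + P x" x] x complex_Re_le_cmod[of "A_inner A (y + P x) x"]
      by simp
    finally have "(a + b)\<^sup>2 \<le> (A_norm A (y + P x))\<^sup>2"
      using nonneg by (intro power_mono) auto
    also have "\<dots> = (A_norm A y)\<^sup>2 + 2 * Re (A_inner A y (P x)) + (A_norm A (P x))\<^sup>2"
      unfolding power2_A_norm[OF A] A_inner_add_left[OF A] A_inner_add_right[OF A]
        A_inner_commute[OF A, of "P x" y]
      by simp
    also have "(A_norm A y)\<^sup>2 + 2 * Re (A_inner A y (P x)) + (A_norm A (P x))\<^sup>2
        = ((A_norm A y)\<^sup>2 + (A_norm A (P x))\<^sup>2) + 2 * Re (A_inner A y (P x))" by simp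
    \<comment> \<open>Since \<open>cmod c = 1\<close>, the first square is that of
      \<open>T x\<close>, which is the form of \<open>P\<close> at \<open>x\<close>; the second is
      the form of \<open>P ^^ 2\<close>, as \<open>P\<close> is symmetric for
      \<open>A_inner\<close>.\<close>
    also have "(A_norm A y)\<^sup>2 + (A_norm A (P x))\<^sup>2 = Re (A_inner A ((P ^^ 2) x + P x) x)"
      by (simp add: y_def A_norm_scaleC[OF A] c power2_A_norm[OF A] PP A_inner_add_left[OF A])
        (simp add: P_def sharp)
    \<comment> \<open>Adjointness is used twice: \<open>X\<close> moves off the second argument as
      \<open>T\<close>, and the remaining \<open>T\<close> moves back as \<open>X\<close>.\<close>
    also have "A_inner A y (P x) = c * A_inner A ((P \<circ> T) x) x"
      by (simp add: y_def A_inner_scaleC_left[OF A] P_def sharp)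
    also have "Re (A_inner A ((P ^^ 2) x + P x) x) + 2 * Re (c * A_inner A ((P \<circ> T) x) x)
        \<le> cmod (A_inner A ((P ^^ 2) x + P x) x) + 2 * cmod (A_inner A ((P \<circ> T) x) x)"
      using complex_Re_le_cmod[of "c * A_inner A ((P \<circ> T) x) x"] c(1)
      by (intro add_mono complex_Re_le_cmod) (simp add: norm_mult)
    also have "\<dots> \<le> ?s"
      using A_numerical_radius_upper[OF A PP_bd x] A_numerical_radius_upper[where S = "P \<circ> T", OF A PT_bd x]
      by simp
    finally have "a + b \<le> sqrt ?s" by (rule real_le_rsqrt)
    have "a\<^sup>2 + b\<^sup>2 = a * a + b * b" by (simp add: power2_eq_square)
    also have "\<dots> \<le> ?m * a + ?m * b"
      using am bm nonneg by (intro add_mono mult_right_mono) auto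
    also have "\<dots> = ?m * (a + b)" by (simp add: distrib_left)
    \<comment> \<open>\<open>?m\<close> is nonnegative because
      \<open>0 \<le> a \<le> ?m\<close>.\<close>
    also have "\<dots> \<le> ?m * sqrt ?s"
      using \<open>a + b \<le> sqrt ?s\<close> am nonneg(1) by (intro mult_left_mono) auto
    finally show ?thesis by (simp add: a_def b_def flip: power_mult)
  qed
  then show ?thesis
    unfolding A_davis_wielandt_radius_def X_def[symmetric] P_def[symmetric]
    using exists_A_norm_1[OF A assms(2)] by (intro cSup_least) auto
qed

end
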